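(* The family $\mathbb{F}(5,3)$ is a CIF$(5,3)$ with exactly $6$ blocks and exactly $76$ transversals. Consequently $\mathrm{M}(5)\ge 234$.
   Context: A family is a non-empty set of non-empty finite sets, called its blocks. A family is uniform if all its blocks have the same size, denoted $\mathrm{k}(\mathcal{G})$. A blocking set of $\mathcal{G}$ is a set meeting every block of $\mathcal{G}$. If $\mathcal{G}$ has a finite blocking set, $\mathrm{tr}(\mathcal{G})$ is the smallest size of a blocking set, a transversal is a blocking set of size $\mathrm{tr}(\mathcal{G})$, and $\mathcal{G}^{\top}$ is the family of all transversals of $\mathcal{G}$; otherwise $\mathrm{tr}(\mathcal{G})=\infty$. The symbol $\sqcup$ denotes disjoint union. A MIF$(k)$ is a uniform family $\mathcal{F}$ with $\mathrm{k}(\mathcal{F})=k$, $\mathrm{tr}(\mathcal{F})<\infty$ and $\mathcal{F}=\mathcal{F}^{\top}$. $\mathrm{M}(k)$ denotes the maximum number of blocks in a MIF$(k)$ (finite, since by Erdős–Lovász a MIF$(k)$ has at most $k^k$ blocks). A CIF$(k,t)$ is a uniform family $\mathcal{F}$ with $\mathrm{k}(\mathcal{F})=k$, $\mathrm{tr}(\mathcal{F})=t\le k-1$ and $\mathcal{F}=(\mathcal{F}\sqcup\mathcal{F}^{\top})^{\top}$. Definition of $\mathbb{F}(k,t)$, for positive integers $t\le k$: let $X_0,\dots,X_{t-1}$ be pairwise disjoint sets with $|X_n|=k-\lfloor t/2\rfloor$ if $0\le n\le\lfloor (t-1)/2\rfloor$ and $|X_n|=k-\lfloor (t-1)/2\rfloor$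 if $\lfloor (t-1)/2\rfloor+1\le n\le t-1$; write $X_n=\{x^n_p:0\le p\le|X_n|-1\}$. Then $\mathbb{F}(k,t)$ is the family of all $k$-sets of the form $X_n\sqcup\{x^{n+i}_{p_i}:1\le i\le k-|X_n|\}$, where $0\le n\le t-1$, superscripts are taken modulo $t$, and $(p_i)_{i\ge0}$ is any integer sequence with $p_0=0$ and $p_{i-1}\le p_i\le p_{i-1}+1$ for $i\ge1$. In particular, for $k=5,t=3$, all three $X_n$ have size $4$ and the blocks are $X_n\sqcup\{x^{n+1}_{p}\}$ with $n\in\{0,1,2\}$, $p\in\{0,1\}$. *)

theory Defs
  imports Main "HOL-Library.Extended_Nat" "HOL-Library.Disjoint_Sets"
begin

definition family :: "'a set set \<Rightarrow> bool" where
  "family G \<longleftrightarrow> G \<noteq> {} \<and> (\<forall>B\<in>G. finite B \<and> B \<noteq> {})"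

definition uniform_family :: "nat \<Rightarrow> 'a set set \<Rightarrow> bool" where
  "uniform_family k G \<longleftrightarrow> family G \<and> (\<forall>B\<in>G. card B = k)"

definition blocking_set :: "'a set set \<Rightarrow> 'a set \<Rightarrow> bool" where
  "blocking_set G S \<longleftrightarrow> (\<forall>B\<in>G. S \<inter> B \<noteq> {})"

text \<open>The infimum over the empty set is \<open>\<infinity>\<close>, which covers families without a finite blocking set.\<close>

definition tr :: "'a set set \<Rightarrow> enat" where
  "tr G = (INF S\<in>{S. finite S \<and> blocking_set G S}. enat (card S))"

definition transversals :: "'a set set \<Rightarrow> 'a set set" where
  "transversals G = {T. finite T \<and> blocking_set G T \<and> enat (card T) = tr G}"

definition MIF :: "nat \<Rightarrow> 'a set set \<Rightarrow> bool" where
  "MIF k F \<longleftrightarrow> uniform_family k F \<and> tr F < \<infinity> \<and> F = transversals F"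

text \<open>The union in the next definition is automatically disjoint: the blocks of \<open>F\<close> have size
  \<open>k\<close>, its transversals have size \<open>t < k\<close>.\<close>

definition CIF :: "nat \<Rightarrow> nat \<Rightarrow> 'a set set \<Rightarrow> bool" where
  "CIF k t F \<longleftrightarrow> uniform_family k F \<and> tr F = enat t \<and> t < k
     \<and> F = transversals (F \<union> transversals F)"

text \<open>By Erdos and Lovasz a MIF of block size \<open>k\<close> has at most \<open>k ^ k\<close> blocks. Hence the maximum
  exists for \<open>k \<ge> 1\<close>, and taking \<open>nat\<close> as ground set loses no generality, because every
  MIF lives on a finite point set.\<close>

definition M :: "nat \<Rightarrow> nat" where
  "M k = Max {card F | F :: nat set set. MIF k F}"

definition X_size :: "nat \<Rightarrow> nat \<Rightarrow> nat \<Rightarrow> nat" where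
  "X_size k t n = (if n \<le> (t - 1) div 2 then k - t div 2 else k - (t - 1) div 2)"

text \<open>\<open>x n p\<close> is the point with superscript \<open>n\<close> and subscript \<open>p\<close>.\<close>

definition X_set :: "nat \<Rightarrow> nat \<Rightarrow> (nat \<Rightarrow> nat \<Rightarrow> 'a) \<Rightarrow> nat \<Rightarrow> 'a set" where
  "X_set k t x n = {x n p | p. p < X_size k t n}"

text \<open>The family is defined from any pairwise disjoint sets of the prescribed sizes, so the
  labelling of the points is kept as a parameter.\<close>

definition labelling :: "nat \<Rightarrow> nat \<Rightarrow> (nat \<Rightarrow> nat \<Rightarrow> 'a) \<Rightarrow> bool" where
  "labelling k t x \<longleftrightarrow> disjoint_family_on (X_set k t x) {..<t}
     \<and> (\<forall>n<t. card (X_set k t x n) = X_size k t n)"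

text \<open>The subscript sequences start at 0 and never decrease, so they may be taken in \<open>nat\<close>.\<close>

definition FF :: "nat \<Rightarrow> nat \<Rightarrow> (nat \<Rightarrow> nat \<Rightarrow> 'a) \<Rightarrow> 'a set set" where
  "FF k t x = {B. card B = k \<and> (\<exists>n<t. \<exists>p :: nat \<Rightarrow> nat.
       p 0 = 0 \<and> (\<forall>i\<ge>1. p (i - 1) \<le> p i \<and> p i \<le> p (i - 1) + 1) \<and>
       B = X_set k t x n \<union> {x ((n + i) mod t) (p i) | i. 1 \<le> i \<and> i \<le> k - X_size k t n})}"

lemma labelling_Pair: "labelling k t Pair"
proof -
  have X: "X_set k t Pair n = Pair n ` {..<X_size k t n}" for n
    by (auto simp: X_set_def)
  show ?thesis
    by (auto simp: labelling_def disjoint_family_on_def X card_image inj_on_def)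
qed

end

theory Submission
  imports Defs
begin

text \<open>Join each of the 76 transversals of the closed family (3 points) with each of the 3 edges of a
  triangle on new points (2 points), and keep the 6 original blocks: this gives
  \<open>6 + 76 * 3 = 234\<close> blocks of size 5. A blocking set of size at most 5 either meets all
  transversals, and is then a block by closedness, or misses some transversal; in that case its
  trace on the new points blocks the triangle and its trace on the old points blocks the closed
  family, so these have 2 and 3 points.\<close>

section \<open>Blocking numbers and transversals\<close>

lemma tr_le:
  assumes "finite S" "blocking_set G S"
  shows "tr G \<le> enat (card S)"
  unfolding tr_def using assms by (intro INF_lower) auto

lemma tr_eqI:
  assumes "finite S" "blocking_set G S" "card S = t"
    and "\<And>S. finite S \<Longrightarrow> blocking_set G S \<Longrightarrow> t \<le> card S"
  shows "tr G = enat t"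
proof (rule antisym)
  show "tr G \<le> enat t" using tr_le[OF assms(1,2)] assms(3) by simp
  show "enat t \<le> tr G" unfolding tr_def using assms(4) by (intro INF_greatest) auto
qed

lemma transversalsD:
  assumes "T \<in> transversals G" "tr G = enat t"
  shows "finite T" "blocking_set G T" "card T = t"
  using assms by (auto simp: transversals_def)

text \<open>Discarding the points that lie in no block leaves a blocking set, so minimality of the
  size rules out such points.\<close>

lemma transversal_subset_Union:
  assumes T: "T \<in> transversals G"
  shows "T \<subseteq> \<Union>G"
proof -
  have fin: "finite T" and "blocking_set G T" and tr: "enat (card T) = tr G"
    using T by (auto simp: transversals_def)
  hence "blocking_set G (T \<inter> \<Union>G)" unfolding blocking_set_def by blast
  hence "card T \<le> card (T \<inter> \<Union>G)" using tr_le[of "T \<inter> \<Union>G" G] fin tr[symmetric] by simp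
  thus ?thesis using card_seteq[of T "T \<inter> \<Union>G"] fin by auto
qed

text \<open>The criterion by which the transversals are computed for the triangle, for the cyclic
  family and for its closure. A blocking set contains a member of \<open>T\<close>, hence has at
  least \<open>t\<close> points; with exactly \<open>t\<close> points it equals that member.\<close>

lemma tr_transversals_eqI:
  assumes ne: "T \<noteq> {}"
    and T: "\<And>U. U \<in> T \<Longrightarrow> finite U \<and> card U = t \<and> blocking_set G U"
    and sub: "\<And>S. finite S \<Longrightarrow> blocking_set G S \<Longrightarrow> \<exists>U\<in>T. U \<subseteq> S"
  shows "tr G = enat t" "transversals G = T"
proof -
  have le: "t \<le> card S" if "finite S" "blocking_set G S" for S
    using sub[OF that] T card_mono[OF that(1)] by metis
  obtain U where "U \<in> T" using ne by blast
  with T le show tr: "tr G = enat t" by (intro tr_eqI[of U]) auto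
  have "S \<in> T" if S: "finite S" "blocking_set G S" "card S = t" for S
    using sub[OF S(1,2)] T S card_subset_eq by metis
  thus "transversals G = T" using T tr by (auto simp: transversals_def)
qed

text \<open>The fixed-point equation makes every block a transversal of
  \<open>F \<union> transversals F\<close>; the size of a single block then reveals the value of
  \<open>tr\<close>, which \<open>CIF\<close> leaves implicit.\<close>

lemma CIF_blocking:
  assumes "CIF k t F"
  shows "tr (F \<union> transversals F) = enat k"
    and "B \<in> F \<Longrightarrow> blocking_set (F \<union> transversals F) B"
proof -
  have eq: "F = transversals (F \<union> transversals F)" and uni: "uniform_family k F"
    using assms by (auto simp: CIF_def)
  from uni obtain C where C: "C \<in> F" "card C = k"
    by (auto simp: uniform_family_def family_def)
  hence "C \<in> transversals (F \<union> transversals F)" using eq by blast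
  with C(2) show "tr (F \<union> transversals F) = enat k" by (simp add: transversals_def)
  show "blocking_set (F \<union> transversals F) B" if "B \<in> F"
  proof -
    have "B \<in> transversals (F \<union> transversals F)" using eq that by blast
    thus ?thesis by (simp add: transversals_def)
  qed
qed

lemma MIF_tr:
  assumes "MIF k F"
  shows "tr F = enat k"
proof -
  have eq: "F = transversals F" and uni: "uniform_family k F"
    using assms by (auto simp: MIF_def)
  from uni obtain C where C: "C \<in> F" "card C = k"
    by (auto simp: uniform_family_def family_def)
  hence "C \<in> transversals F" using eq by blast
  with C(2) show ?thesis by (simp add: transversals_def)
qed

lemma MIF_blocking:
  assumes "MIF k F" "B \<in> F"
  shows "finite B" "card B = k" "blocking_set F B"
proof -
  have "B \<in> transversals F" using assms unfolding MIF_def by blast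
  from transversalsD[OF this MIF_tr[OF assms(1)]]
  show "finite B" "card B = k" "blocking_set F B" by simp_all
qed

section \<open>The Erdos--Lovasz bound\<close>

text \<open>Branching argument: a set \<open>A\<close> with fewer than \<open>k\<close> points
  misses some block \<open>C\<close>, while every block meets \<open>C\<close>. The blocks above
  \<open>A\<close> are thus distributed over the \<open>k\<close> extensions
  \<open>insert c A\<close> with \<open>c \<in> C\<close>, and each added point costs a factor
  \<open>k\<close>.\<close>

lemma MIF_card_supersets:
  assumes F: "MIF k F" and A: "finite A" "card A + m = k"
  shows "finite {B\<in>F. A \<subseteq> B} \<and> card {B\<in>F. A \<subseteq> B} \<le> k ^ m"
  using A
proof (induction m arbitrary: A)
  case 0
  have "B = A" if "B \<in> F" "A \<subseteq> B" for B
    using card_subset_eq[of B A] MIF_blocking(1,2)[OF F that(1)] that(2) 0 by simp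
  hence sub: "{B\<in>F. A \<subseteq> B} \<subseteq> {A}" by blast
  have "finite {B\<in>F. A \<subseteq> B}" by (rule finite_subset[OF sub]) simp
  thus ?case using card_mono[OF _ sub] by simp
next
  case (Suc m)
  \<comment> \<open>\<open>A\<close> has fewer than \<open>k = tr F\<close> points.\<close>
  have "\<not> blocking_set F A"
    using tr_le[of A F] MIF_tr[OF F] Suc.prems by auto
  then obtain C where C: "C \<in> F" "A \<inter> C = {}" by (auto simp: blocking_set_def)
  note finC = MIF_blocking(1)[OF F C(1)]
  let ?P = "\<lambda>A. {B\<in>F. A \<subseteq> B}"
  have IH: "finite (?P (insert c A)) \<and> card (?P (insert c A)) \<le> k ^ m" if "c \<in> C" for c
    using that C(2) Suc.prems by (intro Suc.IH) (auto simp: card_insert_if)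
  have sub: "?P A \<subseteq> (\<Union>c\<in>C. ?P (insert c A))"
  proof
    fix B assume B: "B \<in> ?P A"
    then obtain c where "c \<in> B \<inter> C"
      using MIF_blocking(3)[OF F, of B] C(1) by (auto simp: blocking_set_def)
    thus "B \<in> (\<Union>c\<in>C. ?P (insert c A))" using B by blast
  qed
  have fin: "finite (\<Union>c\<in>C. ?P (insert c A))" using finC IH by blast
  have "card (?P A) \<le> card (\<Union>c\<in>C. ?P (insert c A))" by (rule card_mono[OF fin sub])
  also have "\<dots> \<le> (\<Sum>c\<in>C. card (?P (insert c A)))" by (rule card_UN_le[OF finC])
  also have "\<dots> \<le> (\<Sum>c\<in>C. k ^ m)" using IH by (intro sum_mono) auto
  also have "\<dots> = k ^ Suc m" using MIF_blocking(2)[OF F C(1)] by simp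
  finally show ?case using finite_subset[OF sub fin] by blast
qed

theorem MIF_card_le:
  assumes "MIF k F"
  shows "finite F" "card F \<le> k ^ k"
  using MIF_card_supersets[OF assms, of "{}" k] by auto

text \<open>The bound \<open>k ^ k\<close> makes the set of block counts finite, so that
  \<open>Max\<close> is a genuine upper bound.\<close>

lemma card_le_M:
  fixes F :: "nat set set"
  assumes "MIF k F"
  shows "card F \<le> M k"
proof -
  have "{card F | F :: nat set set. MIF k F} \<subseteq> {..k ^ k}" using MIF_card_le by auto
  hence "finite {card F | F :: nat set set. MIF k F}" using finite_subset by blast
  thus ?thesis unfolding M_def using assms by (intro Max_ge) auto
qed

section \<open>From closed to maximal intersecting families\<close>

definition join_families :: "'a set set \<Rightarrow> 'a set set \<Rightarrow> 'a set set" where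
  "join_families F G = F \<union> (\<lambda>(T, B). T \<union> B) ` (transversals F \<times> G)"

text \<open>Yields at once the lower bound for \<open>tr\<close> and the fact that blocking sets
  attaining it are blocks.\<close>

lemma blocking_join_families:
  assumes F: "CIF k t F" and G: "MIF j G" and k: "k = t + j"
    and disj: "\<Union>F \<inter> \<Union>G = {}"
    and S: "finite S" "blocking_set (join_families F G) S"
  shows "k \<le> card S \<and> (card S = k \<longrightarrow> S \<in> join_families F G)"
proof -
  let ?X = "S \<inter> \<Union>F" and ?Y = "S \<inter> \<Union>G"
  have tr: "tr F = enat t" and eq: "F = transversals (F \<union> transversals F)"
    using F by (auto simp: CIF_def)
  have fin: "finite ?X" "finite ?Y" using S by auto
  have "card ?X + card ?Y = card (?X \<union> ?Y)"
    using disj fin by (intro card_Un_disjoint[symmetric]) auto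
  moreover have "card (?X \<union> ?Y) \<le> card S" using S(1) by (intro card_mono) auto
  ultimately have card: "card ?X + card ?Y \<le> card S" by simp
  have FX: "blocking_set F ?X"
    unfolding blocking_set_def
  proof
    fix B assume "B \<in> F"
    moreover from this have "S \<inter> B \<noteq> {}"
      using S(2) by (simp add: blocking_set_def join_families_def)
    ultimately show "?X \<inter> B \<noteq> {}" by blast
  qed
  show ?thesis
  proof (cases "blocking_set (transversals F) ?X")
    case True
    hence bl: "blocking_set (F \<union> transversals F) ?X" using FX by (auto simp: blocking_set_def)
    \<comment> \<open>The trace on the old points alone already needs \<open>k\<close> points, so
      for \<open>card S = k\<close> it is all of \<open>S\<close>.\<close>
    from tr_le[OF fin(1) bl] CIF_blocking(1)[OF F] have ge: "k \<le> card ?X" by simp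
    moreover have "S \<in> F" if "card S = k"
    proof -
      have X: "card ?X = k" using ge card that by simp
      hence "?X = S" using S(1) that by (intro card_subset_eq) auto
      moreover have "?X \<in> transversals (F \<union> transversals F)"
        using bl X fin CIF_blocking(1)[OF F] unfolding transversals_def by simp
      ultimately show ?thesis using eq by auto
    qed
    ultimately show ?thesis using card by (auto simp: join_families_def)
  next
    case False
    then obtain T where T: "T \<in> transversals F" "?X \<inter> T = {}"
      by (auto simp: blocking_set_def)
    \<comment> \<open>Transversals contain no points outside \<open>\<Union>F\<close>, so all of
      \<open>S\<close> avoids \<open>T\<close> and must meet each \<open>T \<union> B\<close> inside
      \<open>B\<close>.\<close>
    hence ST: "S \<inter> T = {}" using transversal_subset_Union by blast
    have bl: "blocking_set G ?Y" unfolding blocking_set_def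
    proof
      fix B assume B: "B \<in> G"
      hence "T \<union> B \<in> join_families F G" using T(1) by (auto simp: join_families_def)
      hence "S \<inter> (T \<union> B) \<noteq> {}" using S(2) by (auto simp: blocking_set_def)
      thus "?Y \<inter> B \<noteq> {}" using ST B by blast
    qed
    from tr_le[OF fin(2) bl] MIF_tr[OF G] have Y: "j \<le> card ?Y" by simp
    from tr_le[OF fin(1) FX] tr have X: "t \<le> card ?X" by simp
    have "S \<in> join_families F G" if "card S = k"
    proof -
      \<comment> \<open>The lower bounds \<open>t\<close> and \<open>j\<close> add up to
        \<open>k\<close>, so both are attained and \<open>S\<close> has no points beyond the two
        traces.\<close>
      have c: "card ?X = t" "card ?Y = j" using X Y card k that by auto
      have "?X \<in> transversals F" using FX c tr fin by (simp add: transversals_def)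
      moreover have "?Y \<in> transversals G"
        using bl c MIF_tr[OF G] fin by (simp add: transversals_def)
      hence "?Y \<in> G" using G by (auto simp: MIF_def)
      moreover have "card (?X \<union> ?Y) = card S"
        using c k that disj fin by (subst card_Un_disjoint) auto
      hence "?X \<union> ?Y = S" using S(1) by (intro card_subset_eq) auto
      moreover have "?X \<union> ?Y \<in> join_families F G" if "?X \<in> transversals F" "?Y \<in> G"
        using that unfolding join_families_def by blast
      ultimately show ?thesis by simp
    qed
    thus ?thesis using X Y card k by auto
  qed
qed

text \<open>It remains to see that blocks meet pairwise, which makes each of them a blocking set of
  size \<open>k\<close>. A block of \<open>F\<close> meets all blocks and transversals of
  \<open>F\<close>, hence every member; two joined blocks meet in their parts from
  \<open>G\<close>.\<close>

theorem MIF_join_families: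
  assumes F: "CIF k t F" and G: "MIF j G" and k: "k = t + j"
    and disj: "\<Union>F \<inter> \<Union>G = {}"
  shows "MIF k (join_families F G)"
proof -
  let ?N = "join_families F G"
  have tr: "tr F = enat t" and uni: "uniform_family k F" and tk: "t < k"
    using F by (auto simp: CIF_def)
  note T = transversalsD[OF _ tr]
  have card: "finite B \<and> card B = k" if BN: "B \<in> ?N" for B
  proof (cases "B \<in> F")
    case True
    thus ?thesis using uni by (auto simp: uniform_family_def family_def)
  next
    case False
    then obtain U C where U: "U \<in> transversals F" and C: "C \<in> G" and B: "B = U \<union> C"
      using BN by (auto simp: join_families_def)
    have "U \<inter> C = {}" using transversal_subset_Union[OF U] C disj by blast
    thus ?thesis
      using T[OF U] MIF_blocking[OF G C] k card_Un_disjoint[of U C] unfolding B by simp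
  qed
  have FN: "S \<inter> C \<noteq> {}" if "S \<in> F" "C \<in> ?N" for S C
  proof -
    have *: "S \<inter> D \<noteq> {}" if "D \<in> F \<union> transversals F" for D
      using CIF_blocking(2)[OF F \<open>S \<in> F\<close>] that by (simp add: blocking_set_def)
    from \<open>C \<in> ?N\<close> obtain D where "D \<in> F \<union> transversals F" "D \<subseteq> C"
      by (auto simp: join_families_def)
    thus ?thesis using * by blast
  qed
  have NN: "S \<inter> C \<noteq> {}" if S: "S \<in> ?N" and C: "C \<in> ?N" for S C
  proof (cases "S \<in> F \<or> C \<in> F")
    case True
    thus ?thesis using FN[of S C] FN[of C S] S C by blast
  next
    case False
    then obtain B D where "B \<in> G" "D \<in> G" and sub: "B \<subseteq> S" "D \<subseteq> C"
      using S C by (auto simp: join_families_def)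
    hence "B \<inter> D \<noteq> {}" using MIF_blocking(3)[OF G] by (simp add: blocking_set_def)
    thus ?thesis using sub by blast
  qed
  hence bl: "blocking_set ?N S" if "S \<in> ?N" for S using that by (auto simp: blocking_set_def)
  have ne: "?N \<noteq> {}" using uni by (auto simp: uniform_family_def family_def join_families_def)
  then obtain S0 where S0: "S0 \<in> ?N" by blast
  have trN: "tr ?N = enat k"
    using card[OF S0] bl[OF S0] blocking_join_families[OF F G k disj]
    by (intro tr_eqI[of S0]) auto
  have "?N = transversals ?N"
    using trN card bl blocking_join_families[OF F G k disj] by (auto simp: transversals_def)
  \<comment> \<open>The inequality \<open>t < k\<close> gives \<open>k > 0\<close>, so the blocks
    are non-empty.\<close>
  moreover have "uniform_family k ?N"
    using ne card tk unfolding uniform_family_def family_def by fastforce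
  ultimately show ?thesis using trN by (simp add: MIF_def)
qed

text \<open>The traces on the two disjoint ground sets recover \<open>T\<close> and \<open>B\<close>
  from \<open>T \<union> B\<close>, and a non-empty \<open>B\<close> keeps the union out of
  \<open>F\<close>.\<close>

lemma card_join_families:
  assumes disj: "\<Union>F \<inter> \<Union>G = {}"
    and fin: "finite F" "finite (transversals F)" "finite G" and ne: "{} \<notin> G"
  shows "card (join_families F G) = card F + card (transversals F) * card G"
proof -
  let ?f = "\<lambda>(T, B). T \<union> B" and ?P = "transversals F \<times> G"
  have dec: "(T \<union> B) \<inter> \<Union>F = T" "(T \<union> B) \<inter> \<Union>G = B" if "T \<in> transversals F" "B \<in> G" for T B
    using transversal_subset_Union[OF that(1)] that(2) disj by blast+
  have "inj_on ?f ?P"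
  proof (rule inj_onI, clarify)
    fix T B T' B' assume *: "T \<in> transversals F" "B \<in> G" "T' \<in> transversals F" "B' \<in> G"
      "T \<union> B = T' \<union> B'"
    show "T = T' \<and> B = B'" using dec[OF *(1,2)] dec[OF *(3,4)] *(5) by simp
  qed
  hence "card (?f ` ?P) = card (transversals F) * card G"
    by (simp add: card_image card_cartesian_product)
  moreover have "F \<inter> ?f ` ?P = {}"
  proof -
    have "T \<union> B \<notin> F" if "T \<in> transversals F" "B \<in> G" for T B
    proof
      assume "T \<union> B \<in> F"
      hence "B \<subseteq> \<Union>F" by blast
      moreover have "B \<subseteq> \<Union>G" using that(2) by blast
      moreover have "B \<noteq> {}" using that(2) ne by blast
      ultimately show False using disj by blast
    qed
    thus ?thesis by auto
  qed
  ultimately show ?thesis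
    unfolding join_families_def using fin by (subst card_Un_disjoint) auto
qed

text \<open>A set blocking all three edges misses at most one vertex, hence contains an
  edge.\<close>

lemma MIF_triangle:
  assumes "distinct [u, v, w]"
  shows "MIF 2 {{u, v}, {u, w}, {v, w}}" (is "MIF 2 ?G")
proof -
  have U: "finite U \<and> card U = 2 \<and> blocking_set ?G U" if "U \<in> ?G" for U
    using that assms by (auto simp: blocking_set_def)
  have "\<exists>U\<in>?G. U \<subseteq> S" if "blocking_set ?G S" for S
    using that by (auto simp: blocking_set_def)
  from tr_transversals_eqI[OF _ U this]
  have "tr ?G = enat 2" "transversals ?G = ?G" by auto
  thus ?thesis using U by (auto simp: MIF_def uniform_family_def family_def)
qed

section \<open>Three four-sets arranged in a cycle\<close>

text \<open>Indices are read modulo 3; the points \<open>a n\<close> and \<open>b n\<close> play the role of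
  \<open>x\<^sup>n\<^sub>0\<close> and \<open>x\<^sup>n\<^sub>1\<close>.\<close>

lemma mod_3_cases:
  fixes m n :: nat
  shows "m mod 3 = n mod 3 \<or> m mod 3 = (n + 1) mod 3 \<or> m mod 3 = (n + 2) mod 3"
proof -
  have "m mod 3 \<in> {0, 1, 2}" "n mod 3 \<in> {0, 1, 2}"
    using mod_less_divisor[of 3 m] mod_less_divisor[of 3 n] by auto
  thus ?thesis by (auto simp: mod_Suc)
qed

locale cyclic_sets =
  fixes X :: "nat \<Rightarrow> 'a set" and a b :: "nat \<Rightarrow> 'a"
  assumes X_add3 [simp]: "X (n + 3) = X n" and a_add3 [simp]: "a (n + 3) = a n"
    and b_add3 [simp]: "b (n + 3) = b n"
    and card_X [simp]: "card (X n) = 4"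
    and disj_Suc: "X n \<inter> X (n + 1) = {}"
    and a_in [simp]: "a n \<in> X n" and b_in [simp]: "b n \<in> X n" and a_neq_b [simp]: "a n \<noteq> b n"
begin

text \<open>The cyclic form of \<open>FF 5 3\<close>, as \<open>FF_53_eq_blocks\<close> shows.
  Indexing by a dependent sum reduces counting to injectivity.\<close>

definition blocks :: "'a set set" where
  "blocks = (\<lambda>(n, c). insert c (X n)) ` (SIGMA n:{..<3}. {a (n + 1), b (n + 1)})"

text \<open>The transversals that meet all three sets, one point in each.\<close>

definition rainbow :: "'a set set" where
  "rainbow = (\<lambda>(u, v, w). {u, v, w}) ` (X 0 \<times> X 1 \<times> X 2)"

text \<open>The transversals that miss \<open>X n\<close>: both outer points attached to
  \<open>X n\<close> are then forced, and one point of the remaining set completes them.\<close>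

definition doubled :: "'a set set" where
  "doubled = (\<lambda>(n, y). {a (n + 1), b (n + 1), y}) ` (SIGMA n:{..<3}. X (n + 2))"

section \<open>Arithmetic of the cyclic indices\<close>

lemma finite_X [simp]: "finite (X n)"
  using card_X[of n] card.infinite by fastforce

lemma disj_Suc2: "X n \<inter> X (n + 2) = {}"
  using disj_Suc[of "n + 2"] X_add3[of n] by (simp add: eval_nat_numeral Int_commute)

lemma periodic: "X n = X (n mod 3)" "a n = a (n mod 3)" "b n = b (n mod 3)"
proof -
  have *: "f (r + 3 * q) = f r" if "\<And>n. f (n + 3) = f n" for f :: "nat \<Rightarrow> 'b" and r q
  proof (induction q)
    case (Suc q)
    have "f (r + 3 * Suc q) = f (r + 3 * q + 3)" by (simp add: algebra_simps)
    thus ?case using that Suc by simp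
  qed simp
  show "X n = X (n mod 3)" "a n = a (n mod 3)" "b n = b (n mod 3)"
    using *[of X "n mod 3" "n div 3"] *[of a "n mod 3" "n div 3"] *[of b "n mod 3" "n div 3"]
    by simp_all
qed

text \<open>Of two distinct indices modulo 3, one is the cyclic successor of the other. The third
  case records this with \<open>n\<close> as the successor of \<open>m\<close>, so no enumeration of
  index pairs is needed.\<close>

lemma index_cases:
  assumes "n < 3" "m < 3"
  obtains "m = n" | "X m = X (n + 1)" "m \<noteq> n" | "X m = X (n + 2)" "X (m + 1) = X n" "m \<noteq> n"
proof -
  consider "m = n" | "m = (n + 1) mod 3" "m \<noteq> n" | "m = (n + 2) mod 3" "m \<noteq> n"
    using mod_3_cases[of m n] assms by auto
  thus thesis
  proof cases
    case 2
    thus ?thesis using that(2) periodic(1)[of "n + 1"] by simp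
  next
    case 3
    have "(m + 1) mod 3 = (n + 3) mod 3" unfolding 3(1) by (simp add: mod_Suc_eq)
    hence "X (m + 1) = X n" using periodic(1)[of "m + 1"] periodic(1)[of "n + 3"] by simp
    thus ?thesis using that(3) 3 periodic(1)[of "n + 2"] by simp
  qed (use that(1) in simp)
qed

lemma disj:
  assumes "n < 3" "m < 3" "n \<noteq> m"
  shows "X n \<inter> X m = {}"
  by (rule index_cases[OF assms(1,2)]) (use assms disj_Suc disj_Suc2 in auto)

text \<open>Freeing \<open>n\<close> from the bound 3 allows later arguments to pass to
  \<open>n + 1\<close> or \<open>n + 2\<close> without reducing indices.\<close>

lemma block_iff:
  "B \<in> blocks \<longleftrightarrow> (\<exists>n c. B = insert c (X n) \<and> c \<in> {a (n + 1), b (n + 1)})"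
proof
  assume "\<exists>n c. B = insert c (X n) \<and> c \<in> {a (n + 1), b (n + 1)}"
  then obtain n c where B: "B = insert c (X n)" and c: "c \<in> {a (n + 1), b (n + 1)}" by blast
  have "(n + 1) mod 3 = (n mod 3 + 1) mod 3" by presburger
  hence "a (n + 1) = a (n mod 3 + 1)" "b (n + 1) = b (n mod 3 + 1)" using periodic by metis+
  hence "(n mod 3, c) \<in> (SIGMA n:{..<3}. {a (n + 1), b (n + 1)})" using c by simp
  moreover have "B = (\<lambda>(n, c). insert c (X n)) (n mod 3, c)" using B periodic(1)[of n] by simp
  ultimately show "B \<in> blocks" unfolding blocks_def by (rule rev_image_eqI)
qed (auto simp: blocks_def)

lemma doubled_iff:
  "U \<in> doubled \<longleftrightarrow> (\<exists>n. \<exists>y\<in>X (n + 2). U = {a (n + 1), b (n + 1), y})"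
proof
  assume "\<exists>n. \<exists>y\<in>X (n + 2). U = {a (n + 1), b (n + 1), y}"
  then obtain n y where y: "y \<in> X (n + 2)" and U: "U = {a (n + 1), b (n + 1), y}" by blast
  have "(n + 1) mod 3 = (n mod 3 + 1) mod 3" "(n + 2) mod 3 = (n mod 3 + 2) mod 3" by presburger+
  hence "a (n + 1) = a (n mod 3 + 1)" "b (n + 1) = b (n mod 3 + 1)" "X (n + 2) = X (n mod 3 + 2)"
    using periodic by metis+
  hence "U = (\<lambda>(n, y). {a (n + 1), b (n + 1), y}) (n mod 3, y)"
    and "(n mod 3, y) \<in> (SIGMA n:{..<3}. X (n + 2))" using y U by simp_all
  thus "U \<in> doubled" unfolding doubled_def by (rule image_eqI)
qed (auto simp: doubled_def)

lemma outer_notin: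
  assumes "c \<in> {a (n + 1), b (n + 1)}"
  shows "c \<in> X (n + 1)" "c \<notin> X n"
  using assms a_in[of "n + 1"] b_in[of "n + 1"] disj_Suc[of n] by auto

section \<open>Counting blocks, doubled sets and rainbow sets\<close>

lemma card_blocks: "card blocks = 6"
proof -
  have "inj_on (\<lambda>(n, c). insert c (X n)) (SIGMA n:{..<3}. {a (n + 1), b (n + 1)})"
  proof (rule inj_onI, clarify)
    fix n c m d
    assume *: "n < 3" "m < 3" "c \<in> {a (n + 1), b (n + 1)}" "d \<in> {a (m + 1), b (m + 1)}"
      "insert c (X n) = insert d (X m)"
    have "n = m"
    proof (rule ccontr)
      assume "n \<noteq> m"
      \<comment> \<open>\<open>X n\<close> lies in \<open>insert d (X m)\<close> but is disjoint
        from \<open>X m\<close>.\<close>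
      hence "X n \<subseteq> {d}" using disj[of n m] * by blast
      hence "card (X n) \<le> 1" using card_mono[of "{d}" "X n"] by simp
      thus False by simp
    qed
    moreover have "c = d" using outer_notin[OF *(3)] outer_notin[OF *(4)] *(5) \<open>n = m\<close> by blast
    ultimately show "n = m \<and> c = d" by simp
  qed
  thus ?thesis unfolding blocks_def by (simp add: card_image)
qed

lemma card_block:
  assumes "B \<in> blocks"
  shows "finite B \<and> card B = 5"
  using assms outer_notin by (auto simp: block_iff)

lemma doubled_facts:
  assumes "y \<in> X (n + 2)"
  shows "a (n + 1) \<noteq> y" "b (n + 1) \<noteq> y" "{a (n + 1), b (n + 1), y} \<inter> X n = {}"
    "{a (n + 1), b (n + 1), y} \<inter> X (n + 2) = {y}"
proof -
  have "X (n + 1) \<inter> X (n + 2) = {}" using disj_Suc[of "n + 1"] by (simp add: eval_nat_numeral)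
  thus "a (n + 1) \<noteq> y" "b (n + 1) \<noteq> y" "{a (n + 1), b (n + 1), y} \<inter> X n = {}"
    "{a (n + 1), b (n + 1), y} \<inter> X (n + 2) = {y}"
    using assms a_in[of "n + 1"] b_in[of "n + 1"] disj_Suc[of n] disj_Suc2[of n] by blast+
qed

text \<open>A doubled set determines \<open>n\<close> through the set \<open>X n\<close> that it
  misses, and then \<open>y\<close> as its trace on \<open>X (n + 2)\<close>; this gives 3 * 4
  sets.\<close>

lemma card_doubled: "card doubled = 12"
proof -
  have "inj_on (\<lambda>(n, y). {a (n + 1), b (n + 1), y}) (SIGMA n:{..<3}. X (n + 2))"
  proof (rule inj_onI, clarify)
    fix n y m z
    assume *: "n < 3" "m < 3" "y \<in> X (n + 2)" "z \<in> X (m + 2)"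
      "{a (n + 1), b (n + 1), y} = {a (m + 1), b (m + 1), z}"
    have "n = m"
      using *(1,2)
    proof (cases rule: index_cases)
      case 2
      have "a (n + 1) \<in> X m" using 2 by simp
      thus ?thesis using doubled_facts(3)[OF *(4)] *(5) by blast
    next
      case 3
      thus ?thesis using doubled_facts(3)[OF *(4)] *(3,5) by blast
    qed simp
    moreover have "{y} = {z}"
      using doubled_facts(4)[OF *(3)] doubled_facts(4)[OF *(4)] *(5) \<open>n = m\<close> by metis
    ultimately show "n = m \<and> y = z" by simp
  qed
  thus ?thesis unfolding doubled_def by (simp add: card_image)
qed

lemma disj012: "X 0 \<inter> X 1 = {}" "X 0 \<inter> X 2 = {}" "X 1 \<inter> X 2 = {}"
  using disj[of 0 1] disj[of 0 2] disj[of 1 2] by auto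

lemma rainbow_Int:
  assumes "u \<in> X 0" "v \<in> X 1" "w \<in> X 2"
  shows "{u, v, w} \<inter> X 0 = {u}" "{u, v, w} \<inter> X 1 = {v}" "{u, v, w} \<inter> X 2 = {w}"
  using assms disj012 by auto

lemma card_rainbow: "card rainbow = 64"
proof -
  have "inj_on (\<lambda>(u, v, w). {u, v, w}) (X 0 \<times> X 1 \<times> X 2)"
  proof (rule inj_onI)
    fix s s' assume s: "s \<in> X 0 \<times> X 1 \<times> X 2" and s': "s' \<in> X 0 \<times> X 1 \<times> X 2"
      and eq: "(case s of (u, v, w) \<Rightarrow> {u, v, w}) = (case s' of (u, v, w) \<Rightarrow> {u, v, w})"
    obtain u v w where uvw: "s = (u, v, w)" "u \<in> X 0" "v \<in> X 1" "w \<in> X 2" using s by blast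
    obtain u' v' w' where uvw': "s' = (u', v', w')" "u' \<in> X 0" "v' \<in> X 1" "w' \<in> X 2" using s' by blast
    have "{u, v, w} = {u', v', w'}" using eq uvw(1) uvw'(1) by simp
    hence "{u} = {u'}" "{v} = {v'}" "{w} = {w'}"
      using rainbow_Int[OF uvw(2-4)] rainbow_Int[OF uvw'(2-4)] by metis+
    thus "s = s'" using uvw(1) uvw'(1) by simp
  qed
  thus ?thesis unfolding rainbow_def by (simp add: card_image card_cartesian_product)
qed

lemma rainbow_meets:
  assumes "U \<in> rainbow"
  shows "U \<inter> X n \<noteq> {}"
proof -
  have "n mod 3 = 0 \<or> n mod 3 = 1 \<or> n mod 3 = 2" by presburger
  hence "X n = X 0 \<or> X n = X 1 \<or> X n = X 2" using periodic(1) by metis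
  thus ?thesis using assms unfolding rainbow_def by auto
qed

lemma rainbow_doubled_disj: "rainbow \<inter> doubled = {}"
proof -
  have "U \<notin> rainbow" if U: "U \<in> doubled" for U
  proof -
    obtain n y where "y \<in> X (n + 2)" "U = {a (n + 1), b (n + 1), y}"
      using U unfolding doubled_iff by blast
    hence "U \<inter> X n = {}" using doubled_facts(3) by simp
    thus ?thesis using rainbow_meets by blast
  qed
  thus ?thesis by blast
qed

section \<open>Blocking sets and transversals of the cyclic family\<close>

lemma blocking_iff:
  "blocking_set blocks S \<longleftrightarrow> (\<forall>n. S \<inter> X n \<noteq> {} \<or> {a (n + 1), b (n + 1)} \<subseteq> S)"
proof -
  \<comment> \<open>The two blocks over \<open>X n\<close> differ only in the outer point, so a
    blocking set missing \<open>X n\<close> must contain both outer points.\<close>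
  have "blocking_set blocks S \<longleftrightarrow>
      (\<forall>n. S \<inter> insert (a (n + 1)) (X n) \<noteq> {} \<and> S \<inter> insert (b (n + 1)) (X n) \<noteq> {})"
    unfolding blocking_set_def Ball_def block_iff by (rule iffI) (clarsimp, auto)
  thus ?thesis by auto
qed

lemma doubled_blocking:
  assumes "y \<in> X (n + 2)"
  shows "blocking_set blocks {a (n + 1), b (n + 1), y}"
proof -
  \<comment> \<open>The set meets \<open>X (n + 1)\<close> in \<open>a (n + 1)\<close> and
    \<open>X (n + 2)\<close> in \<open>y\<close>; for \<open>m\<close> congruent to \<open>n\<close>
    it contains both outer points.\<close>
  have "{a (n + 1), b (n + 1), y} \<inter> X m \<noteq> {} \<or> X m = X n \<and> a (m + 1) = a (n + 1) \<and> b (m + 1) = b (n + 1)"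
    for m
  proof -
    have "(m + 1) mod 3 = (n + 1) mod 3" if "m mod 3 = n mod 3"
      using that by (metis mod_add_left_eq)
    with mod_3_cases[of m n] consider "X m = X n" "a (m + 1) = a (n + 1)" "b (m + 1) = b (n + 1)"
      | "X m = X (n + 1)" | "X m = X (n + 2)"
      using periodic by metis
    thus ?thesis by cases (use assms a_in[of "n + 1"] in auto)
  qed
  thus ?thesis unfolding blocking_iff by blast
qed

lemma tr_blocks: "tr blocks = enat 3"
  and transversals_blocks: "transversals blocks = rainbow \<union> doubled"
proof -
  have ne: "rainbow \<union> doubled \<noteq> {}" using card_rainbow by auto
  have U: "finite U \<and> card U = 3 \<and> blocking_set blocks U" if UT: "U \<in> rainbow \<union> doubled" for U
  proof (cases "U \<in> rainbow")
    case True
    then obtain u v w where uvw: "u \<in> X 0" "v \<in> X 1" "w \<in> X 2" "U = {u, v, w}"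
      by (auto simp: rainbow_def)
    hence "distinct [u, v, w]" using disj012 by auto
    moreover have "blocking_set blocks U" unfolding blocking_iff using rainbow_meets[OF True] by blast
    ultimately show ?thesis using uvw by auto
  next
    case False
    then obtain n y where "y \<in> X (n + 2)" "U = {a (n + 1), b (n + 1), y}"
      using UT by (auto simp: doubled_iff)
    thus ?thesis using doubled_facts(1,2) doubled_blocking a_neq_b[of "n + 1"] by simp
  qed
  have sub: "\<exists>U\<in>rainbow \<union> doubled. U \<subseteq> S" if S: "blocking_set blocks S" for S
  proof (cases "\<forall>n. S \<inter> X n \<noteq> {}")
    case True
    then obtain u v w where "u \<in> S \<inter> X 0" "v \<in> S \<inter> X 1" "w \<in> S \<inter> X 2"
      by (meson ex_in_conv)
    hence "{u, v, w} \<subseteq> S" "{u, v, w} \<in> rainbow" by (auto simp: rainbow_def)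
    thus ?thesis by blast
  next
    case False
    then obtain n where n: "S \<inter> X n = {}" by blast
    hence ab: "{a (n + 1), b (n + 1)} \<subseteq> S" using S by (auto simp: blocking_iff)
    \<comment> \<open>The block over \<open>X (n + 2)\<close> with outer point
      \<open>a (n + 3) = a n\<close>, a point of the missed set \<open>X n\<close>, can be met only
      inside \<open>X (n + 2)\<close>.\<close>
    have "a (n + 2 + 1) = a n" using a_add3[of n] by (simp add: eval_nat_numeral)
    hence "a (n + 2 + 1) \<notin> S" using n a_in[of n] by auto
    then obtain y where "y \<in> S" "y \<in> X (n + 2)"
      using S unfolding blocking_iff by blast
    hence "{a (n + 1), b (n + 1), y} \<in> doubled" "{a (n + 1), b (n + 1), y} \<subseteq> S"
      using ab by (auto simp: doubled_iff)
    thus ?thesis by blast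
  qed
  show "tr blocks = enat 3" "transversals blocks = rainbow \<union> doubled"
    using tr_transversals_eqI[OF ne U sub] by auto
qed

lemma card_transversals_blocks: "card (transversals blocks) = 76"
proof -
  have "finite rainbow" "finite doubled"
    using card_rainbow card_doubled by (simp_all add: card_ge_0_finite)
  thus ?thesis
    unfolding transversals_blocks
    using rainbow_doubled_disj card_rainbow card_doubled by (subst card_Un_disjoint) auto
qed

text \<open>For distinct indices, the outer point of the cyclic predecessor lies in the core of its
  successor.\<close>

lemma blocks_intersect:
  assumes "B \<in> blocks" "C \<in> blocks"
  shows "B \<inter> C \<noteq> {}"
proof -
  from assms obtain n c m d where n: "n < 3" "c \<in> {a (n + 1), b (n + 1)}" "B = insert c (X n)"
    and m: "m < 3" "d \<in> {a (m + 1), b (m + 1)}" "C = insert d (X m)"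
    by (auto simp: blocks_def)
  from n(1) m(1) show ?thesis
  proof (cases rule: index_cases)
    case 1
    hence "a n \<in> B \<inter> C" using n m by simp
    thus ?thesis by blast
  next
    case 2
    hence "c \<in> B \<inter> C" using n m outer_notin(1)[OF n(2)] by simp
    thus ?thesis by blast
  next
    case 3
    hence "d \<in> B \<inter> C" using n m outer_notin(1)[OF m(2)] by simp
    thus ?thesis by blast
  qed
qed

text \<open>By the transversal criterion it suffices to find a block inside each blocking set of the
  enlarged family. Rainbow sets force a whole \<open>X n\<close> into it; doubled sets then supply
  an outer point or all of \<open>X (n + 2)\<close>.\<close>

lemma CIF_blocks: "CIF 5 3 blocks"
proof -
  let ?T = "rainbow \<union> doubled"
  have ne: "blocks \<noteq> {}" using card_blocks by auto
  have B: "finite B \<and> card B = 5 \<and> blocking_set (blocks \<union> ?T) B" if "B \<in> blocks" for B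
  proof -
    have "blocking_set blocks U" if "U \<in> ?T" for U
      using that transversalsD(2)[OF _ tr_blocks] transversals_blocks by blast
    \<comment> \<open>Meeting is symmetric: every transversal meets \<open>B\<close>, so
      \<open>B\<close> meets every transversal.\<close>
    hence "blocking_set ?T B" using that unfolding blocking_set_def by (metis Int_commute)
    thus ?thesis
      using card_block[OF that] blocks_intersect[OF that] by (auto simp: blocking_set_def)
  qed
  have sub: "\<exists>B\<in>blocks. B \<subseteq> S" if "blocking_set (blocks \<union> ?T) S" for S
  proof -
    have S: "blocking_set rainbow S" "blocking_set doubled S"
      using that by (auto simp: blocking_set_def)
    have "\<exists>n. X n \<subseteq> S"
    proof (rule ccontr)
      assume "\<nexists>n. X n \<subseteq> S"
      hence "X n - S \<noteq> {}" for n by simp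
      then obtain u v w where "u \<in> X 0 - S" "v \<in> X 1 - S" "w \<in> X 2 - S" by (meson ex_in_conv)
      hence "{u, v, w} \<in> rainbow" "S \<inter> {u, v, w} = {}" by (auto simp: rainbow_def)
      thus False using S(1) by (auto simp: blocking_set_def)
    qed
    then obtain n where n: "X n \<subseteq> S" by blast
    show ?thesis
    proof (cases "a (n + 1) \<in> S \<or> b (n + 1) \<in> S")
      case True
      then obtain c where "c \<in> {a (n + 1), b (n + 1)}" "c \<in> S" by blast
      hence "insert c (X n) \<in> blocks" "insert c (X n) \<subseteq> S" using n unfolding block_iff by blast+
      thus ?thesis by blast
    next
      case False
      \<comment> \<open>Both outer points are absent, so each doubled set over \<open>n\<close> can
        be met only in \<open>y\<close>. The block over \<open>X (n + 2)\<close> then lies in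
        \<open>S\<close>, since its outer point \<open>a (n + 3) = a n\<close> belongs to
        \<open>X n\<close>.\<close>
      have "X (n + 2) \<subseteq> S"
      proof
        fix y assume "y \<in> X (n + 2)"
        hence "{a (n + 1), b (n + 1), y} \<in> doubled" by (auto simp: doubled_iff)
        thus "y \<in> S" using S(2) False by (auto simp: blocking_set_def)
      qed
      moreover have "a (n + 2 + 1) \<in> S"
        using n a_in[of n] a_add3[of n] by (auto simp: eval_nat_numeral)
      moreover have "insert (a (n + 2 + 1)) (X (n + 2)) \<in> blocks"
        unfolding block_iff by blast
      ultimately show ?thesis by blast
    qed
  qed
  have "transversals (blocks \<union> ?T) = blocks"
    using tr_transversals_eqI[OF ne B sub] by auto
  moreover have "uniform_family 5 blocks"
    using ne card_block unfolding uniform_family_def family_def by fastforce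
  ultimately show ?thesis by (simp add: CIF_def tr_blocks transversals_blocks)
qed

end

section \<open>The family FF 5 3\<close>

lemma X_size_53: "X_size 5 3 n = 4"
  by (simp add: X_size_def)

lemma X_set_53: "X_set 5 3 x n = x n ` {..<4}"
  by (auto simp: X_set_def X_size_53)

lemma cyclic_sets_labelling:
  assumes "labelling 5 3 x"
  shows "cyclic_sets (\<lambda>n. X_set 5 3 x (n mod 3)) (\<lambda>n. x (n mod 3) 0) (\<lambda>n. x (n mod 3) 1)"
proof
  fix n :: nat
  show c: "card (X_set 5 3 x (n mod 3)) = 4" using assms by (auto simp: labelling_def X_size_53)
  show "X_set 5 3 x (n mod 3) \<inter> X_set 5 3 x ((n + 1) mod 3) = {}"
  proof -
    have "n mod 3 \<noteq> (n + 1) mod 3" by presburger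
    thus ?thesis using assms by (auto simp: labelling_def disjoint_family_on_def)
  qed
  show "x (n mod 3) 0 \<noteq> x (n mod 3) 1"
  proof -
    \<comment> \<open>Distinctness of the subscripted points is implicit in
      \<open>labelling\<close>: an image of \<open>{..<4}\<close> with 4 elements forces
      injectivity.\<close>
    have "inj_on (x (n mod 3)) {..<4}" using c by (intro eq_card_imp_inj_on) (auto simp: X_set_53)
    thus ?thesis using inj_onD[of "x (n mod 3)" "{..<4}" 0 1] by auto
  qed
qed (auto simp: X_set_53)

text \<open>Since \<open>5 - X_size 5 3 n = 1\<close>, only \<open>p 1\<close> enters a block, and
  it ranges over 0 and 1.\<close>

lemma FF_53_eq_blocks:
  assumes "labelling 5 3 x"
  shows "FF 5 3 x = cyclic_sets.blocks (\<lambda>n. X_set 5 3 x (n mod 3)) (\<lambda>n. x (n mod 3) 0) (\<lambda>n. x (n mod 3) 1)"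
    (is "_ = ?F")
proof -
  interpret cyclic_sets "\<lambda>n. X_set 5 3 x (n mod 3)" "\<lambda>n. x (n mod 3) 0" "\<lambda>n. x (n mod 3) 1"
    by (rule cyclic_sets_labelling[OF assms])
  have one: "{x ((n + i) mod 3) (p i) | i. 1 \<le> i \<and> i \<le> 5 - X_size 5 3 n} = {x ((n + 1) mod 3) (p 1)}"
    for n p
  proof -
    have "1 \<le> i \<and> i \<le> 5 - X_size 5 3 n \<longleftrightarrow> i = 1" for i :: nat by (auto simp: X_size_53)
    thus ?thesis by simp
  qed
  show ?thesis
  proof (intro equalityI subsetI)
    fix B assume "B \<in> FF 5 3 x"
    then obtain n and p :: "nat \<Rightarrow> nat" where "n < 3" "p 0 = 0"
      and p: "\<forall>i\<ge>1. p (i - 1) \<le> p i \<and> p i \<le> p (i - 1) + 1"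
      and B: "B = X_set 5 3 x n \<union> {x ((n + 1) mod 3) (p 1)}"
      unfolding FF_def one by blast
    have "p 1 = 0 \<or> p 1 = 1" using p[rule_format, of 1] \<open>p 0 = 0\<close> by auto
    hence "B = insert (x ((n + 1) mod 3) (p 1)) (X_set 5 3 x (n mod 3)) \<and>
      x ((n + 1) mod 3) (p 1) \<in> {x ((n + 1) mod 3) 0, x ((n + 1) mod 3) 1}"
      using B \<open>n < 3\<close> by auto
    thus "B \<in> blocks" unfolding block_iff by blast
  next
    fix B assume B: "B \<in> blocks"
    then obtain n c where "(n, c) \<in> (SIGMA n:{..<3}. {x ((n + 1) mod 3) 0, x ((n + 1) mod 3) 1})"
      "B = insert c (X_set 5 3 x (n mod 3))"
      unfolding blocks_def by blast
    hence n: "n < 3" "c \<in> {x ((n + 1) mod 3) 0, x ((n + 1) mod 3) 1}" "B = insert c (X_set 5 3 x n)"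
      by simp_all
    then obtain q :: nat where q: "q \<le> 1" "c = x ((n + 1) mod 3) q" by auto
    \<comment> \<open>An admissible sequence with prescribed \<open>p 1 = q\<close>: it rises to
      \<open>q\<close> and stays there.\<close>
    define p where "p = (\<lambda>i. min i q)"
    have p: "p 0 = 0 \<and> (\<forall>i\<ge>1. p (i - 1) \<le> p i \<and> p i \<le> p (i - 1) + 1)" by (auto simp: p_def)
    have "p 1 = q" using q by (simp add: p_def)
    hence "B = X_set 5 3 x n \<union> {x ((n + i) mod 3) (p i) | i. 1 \<le> i \<and> i \<le> 5 - X_size 5 3 n}"
      unfolding one using n q by simp
    moreover have "card B = 5" using card_block[OF B] by simp
    ultimately show "B \<in> FF 5 3 x" unfolding FF_def using p n(1) by blast
  qed
qed

theorem FF_53: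
  assumes "labelling 5 3 x"
  shows "CIF 5 3 (FF 5 3 x)" "card (FF 5 3 x) = 6" "card (transversals (FF 5 3 x)) = 76"
proof -
  interpret cyclic_sets "\<lambda>n. X_set 5 3 x (n mod 3)" "\<lambda>n. x (n mod 3) 0" "\<lambda>n. x (n mod 3) 1"
    by (rule cyclic_sets_labelling[OF assms])
  show "CIF 5 3 (FF 5 3 x)" "card (FF 5 3 x) = 6" "card (transversals (FF 5 3 x)) = 76"
    using CIF_blocks card_blocks card_transversals_blocks by (simp_all add: FF_53_eq_blocks[OF assms])
qed

text \<open>Locates the ground set, so that the triangle can be placed away from it.\<close>

lemma Union_FF_53:
  assumes "labelling 5 3 x"
  shows "\<Union>(FF 5 3 x) \<subseteq> (\<Union>n<3. X_set 5 3 x n)"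
proof -
  interpret cyclic_sets "\<lambda>n. X_set 5 3 x (n mod 3)" "\<lambda>n. x (n mod 3) 0" "\<lambda>n. x (n mod 3) 1"
    by (rule cyclic_sets_labelling[OF assms])
  have "B \<subseteq> (\<Union>n<3. X_set 5 3 x n)" if "B \<in> blocks" for B
  proof -
    from that obtain n c where "B = insert c (X_set 5 3 x (n mod 3))" "c \<in> X_set 5 3 x ((n + 1) mod 3)"
      unfolding block_iff using outer_notin(1) by blast
    moreover have "n mod 3 < 3" "(n + 1) mod 3 < 3" by simp_all
    ultimately show ?thesis by blast
  qed
  thus ?thesis unfolding FF_53_eq_blocks[OF assms] by blast
qed

section \<open>The lower bound for block size 5\<close>

lemma M_5_ge: "M 5 \<ge> 234"
proof -
  \<comment> \<open>Consecutive intervals of length 4: the three sets fill 0 to 11, leaving 12, 13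
    and 14 for the triangle.\<close>
  define x :: "nat \<Rightarrow> nat \<Rightarrow> nat" where "x = (\<lambda>n p. 4 * n + p)"
  have X: "X_set 5 3 x n = {4 * n..<4 * n + 4}" for n
    unfolding X_set_53 x_def lessThan_atLeast0 by (simp add: image_add_atLeastLessThan add.commute)
  have lab: "labelling 5 3 x"
    by (auto simp: labelling_def disjoint_family_on_def X X_size_53)
  define G :: "nat set set" where "G = {{12, 13}, {12, 14}, {13, 14}}"
  have G: "MIF 2 G" unfolding G_def by (rule MIF_triangle) simp
  have "(\<Union>n<3. X_set 5 3 x n) \<subseteq> {..<12}" by (auto simp: X)
  hence disj: "\<Union>(FF 5 3 x) \<inter> \<Union>G = {}"
    using Union_FF_53[OF lab] by (fastforce simp: G_def)
  note FF = FF_53[OF lab]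
  have fin: "finite (FF 5 3 x)" "finite (transversals (FF 5 3 x))"
    using FF(2,3) by (simp_all add: card_ge_0_finite)
  have "card G = 3" by (simp add: G_def doubleton_eq_iff)
  hence "card (join_families (FF 5 3 x) G) = 234"
    using card_join_families[OF disj fin] FF(2,3) by (simp add: G_def)
  moreover have "MIF 5 (join_families (FF 5 3 x) G)"
    by (rule MIF_join_families[OF FF(1) G _ disj]) simp
  ultimately show ?thesis using card_le_M by metis
qed

theorem mainTheorem5:
  shows "(\<forall>x :: nat \<Rightarrow> nat \<Rightarrow> 'a. labelling 5 3 x \<longrightarrow>
             CIF 5 3 (FF 5 3 x) \<and> card (FF 5 3 x) = 6 \<and> card (transversals (FF 5 3 x)) = 76)
         \<and> M 5 \<ge> 234"
  by (intro conjI allI impI FF_53 M_5_ge)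

end
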